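(* The relation $\sim$ on $\mathbb N$ defined by $$a\sim b\iff \exists\, i,j\ge 0 \text{ such that } T^i(a)=T^j(b)$$ is an equivalence relation, and its equivalence classes are exactly the connected components of the graph $\Gamma$. In particular, the assertion "for all $m,n\in\mathbb N$ there exist $i,j\ge0$ with $T^i(m)=T^j(n)$" holds if and only if $\Gamma$ is connected.
   Context: $\mathbb N=\{1,2,3,\dots\}$; $\tau(n)=\sum_{d\mid n}1$ is the divisor function; $T:\mathbb N\to\mathbb N$ is $T(n)=n+\tau(n)$, and $T^i$ denotes the $i$-th iterate ($T^0$ is the identity). $\Gamma$ is the undirected graph with vertex set $\mathbb N$ and edge set $\{\{n,T(n)\}:n\in\mathbb N\}$. *)

theory Defs
  imports "Graph_Theory.Digraph_Component"
begin

abbreviation pos_nats :: "nat set" where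
  "pos_nats \<equiv> {1..}"

definition tau :: "nat \<Rightarrow> nat" where
  "tau n = (\<Sum>d | d dvd n. 1)"

text \<open>Only the values at positive arguments matter; \<open>T\<close> maps \<open>pos_nats\<close> into itself.\<close>

definition T :: "nat \<Rightarrow> nat" where
  "T n = n + tau n"

definition T_rel :: "(nat \<times> nat) set" where
  "T_rel = {(a, b). a \<in> pos_nats \<and> b \<in> pos_nats \<and> (\<exists>i j. (T ^^ i) a = (T ^^ j) b)}"

definition Gamma_edges :: "nat set set" where
  "Gamma_edges = {{n, T n} | n. n \<in> pos_nats}"

text \<open>
  As usual in \<open>Graph_Theory\<close>, an undirected graph is represented by the symmetric digraph
  having both arcs \<open>(u, v)\<close> and \<open>(v, u)\<close> for each edge \<open>{u, v}\<close>. The library's locale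
  \<open>graph\<close> does not apply, since it demands finiteness.
\<close>

definition Gamma :: "(nat, nat \<times> nat) pre_digraph" where
  "Gamma = \<lparr> verts = pos_nats, arcs = {(u, v). {u, v} \<in> Gamma_edges}, tail = fst, head = snd \<rparr>"

text \<open>
  The vertex sets of the maximal connected subgraphs. The predicate
  \<open>Digraph_Component.connected\<close> ignores the direction of arcs and excludes the null graph.
\<close>

definition connected_components :: "('a, 'b) pre_digraph \<Rightarrow> 'a set set" where
  "connected_components G = verts ` {H. pre_digraph.max_subgraph G Digraph_Component.connected H}"

end

theory Submission
  imports Defs
begin

text \<open>
  The relation \<open>\<sim>\<close> is reachability in \<open>\<Gamma>\<close> (\<open>reachable_Gamma_iff\<close>). If \<open>T\<^sup>i a = T\<^sup>j b\<close>, then walking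
  forward from \<open>a\<close> to this common value and backward to \<open>b\<close> stays inside \<open>\<Gamma>\<close>. Conversely, the
  property that the forward orbits of \<open>a\<close> and the current vertex meet survives every step of a
  walk: a forward step lets the orbit of \<open>a\<close> run one step further, and a backward step lengthens
  the orbit of the current vertex by one.

  The rest is a fact about arbitrary symmetric digraphs: reachability is an equivalence relation
  on the vertices, and its classes are the vertex sets of the maximal connected subgraphs
  (\<open>quotient_reachable_eq_connected_components\<close>). In particular, transitivity of \<open>\<sim>\<close> comes
  from concatenating walks. Connectedness of \<open>\<Gamma>\<close> means that any two vertices reach each other,
  which gives the final equivalence.
\<close>

lemma (in sym_digraph) equiv_reachable:
  "equiv (verts G) {(u, v). u \<rightarrow>\<^sup>* v}"
  by (auto simp: equiv_def intro!: refl_onI symI transI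
      intro: reachable_in_verts symmetric_reachable' reachable_trans)

lemma (in sym_digraph) connected_iff_reachable:
  "Digraph_Component.connected G \<longleftrightarrow> verts G \<noteq> {} \<and> (\<forall>u\<in>verts G. \<forall>v\<in>verts G. u \<rightarrow>\<^sup>* v)"
  using reachable_mk_symmetric_eq[OF sym_arcs]
  by (simp add: connected_def strongly_connected_def)

lemma (in sym_digraph) induced_subgraph_induce_reachable:
  "induced_subgraph (G \<restriction> {v. u \<rightarrow>\<^sup>* v}) G"
  by (intro induced_induce) (auto elim: reachable_in_vertsE)

lemmas (in sym_digraph) subgraph_induce_reachable =
  induced_imp_subgraph[OF induced_subgraph_induce_reachable]

lemma (in sym_digraph) connected_induce_reachable:
  assumes "u \<in> verts G"
  shows "Digraph_Component.connected (G \<restriction> {v. u \<rightarrow>\<^sup>* v})" (is "Digraph_Component.connected ?C")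
proof -
  interpret C: sym_digraph ?C
    by (rule induced_graph_imp_graph[OF induced_subgraph_induce_reachable])
  have "strongly_connected ?C"
    using induce_reachable_is_in_sccs[OF assms] by blast
  then show ?thesis
    by (auto simp: C.connected_iff_reachable strongly_connected_def)
qed

text \<open>
  A connected subgraph of a symmetric digraph need not be symmetric: it may keep only one of two
  opposite arcs. Its undirected walks are nevertheless walks of the ambient graph, which has both.
\<close>

lemma (in sym_digraph) connected_subgraph_reachable:
  assumes "subgraph H G" "Digraph_Component.connected H" "u \<in> verts H" "v \<in> verts H"
  shows "u \<rightarrow>\<^sup>* v"
proof -
  have "u \<rightarrow>\<^sup>*\<^bsub>mk_symmetric H\<^esub> v"
    using assms(2-4) by (auto simp: connected_def strongly_connected_def)
  then have "u \<rightarrow>\<^sup>*\<^bsub>mk_symmetric G\<^esub> v"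
    by (rule pre_digraph.reachable_mono) (rule subgraph_mk_symmetric[OF assms(1)])
  then show ?thesis
    by (simp only: reachable_mk_symmetric_eq[OF sym_arcs])
qed

lemma (in sym_digraph) connected_subgraph_le_induce_reachable:
  assumes "subgraph H G" "Digraph_Component.connected H" "u \<in> verts H"
  shows "subgraph H (G \<restriction> {v. u \<rightarrow>\<^sup>* v})"
proof -
  have sub: "verts H \<subseteq> {v. u \<rightarrow>\<^sup>* v}"
    using connected_subgraph_reachable[OF assms] by blast
  have H: "wf_digraph H" "arcs H \<subseteq> arcs G" "compatible G H"
    using assms(1) by auto
  have "tail G e \<in> verts H \<and> head G e \<in> verts H" if "e \<in> arcs H" for e
    using that H by (simp add: compatible_tail compatible_head wf_digraph.wellformed)
  then show ?thesis
    using sub H by (intro subgraphI) (auto simp: compatible_def)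
qed

text \<open>
  A connected subgraph through \<open>u\<close> lies inside the subgraph induced on the vertices reachable from
  \<open>u\<close>, and the latter is connected; so it is the greatest connected subgraph through \<open>u\<close>, and a
  maximal one has to coincide with it.
\<close>

lemma (in sym_digraph) max_connected_subgraph_iff:
  "max_subgraph Digraph_Component.connected H
    \<longleftrightarrow> (\<exists>u\<in>verts G. H = G \<restriction> {v. u \<rightarrow>\<^sup>* v})"
proof
  assume max: "max_subgraph Digraph_Component.connected H"
  then have H: "subgraph H G" "Digraph_Component.connected H"
    by (auto simp: max_subgraph_def)
  then obtain u where u: "u \<in> verts H"
    by (auto simp: connected_def strongly_connected_def)
  with H have uG: "u \<in> verts G" by auto
  moreover have "H = G \<restriction> {v. u \<rightarrow>\<^sup>* v}"
    using max connected_subgraph_le_induce_reachable[OF H u]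
      connected_induce_reachable[OF uG] subgraph_induce_reachable[of u]
    unfolding max_subgraph_def by metis
  ultimately show "\<exists>u\<in>verts G. H = G \<restriction> {v. u \<rightarrow>\<^sup>* v}" by blast
next
  assume "\<exists>u\<in>verts G. H = G \<restriction> {v. u \<rightarrow>\<^sup>* v}"
  then obtain u where u: "u \<in> verts G" and H: "H = G \<restriction> {v. u \<rightarrow>\<^sup>* v}" by blast
  have "H' = H" if H': "subgraph H H'" "subgraph H' G" "Digraph_Component.connected H'" for H'
  proof -
    have "u \<in> verts H" using u H by simp
    then have "u \<in> verts H'" using H'(1) by blast
    then have "subgraph H' H"
      unfolding H by (rule connected_subgraph_le_induce_reachable[OF H'(2,3)])
    with H'(1) show ?thesis
      by (auto simp: subgraph_def compatible_def intro: pre_digraph.equality)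
  qed
  then show "max_subgraph Digraph_Component.connected H"
    using u subgraph_induce_reachable connected_induce_reachable
    unfolding max_subgraph_def H by blast
qed

lemma (in sym_digraph) quotient_reachable_eq_connected_components:
  "verts G // {(u, v). u \<rightarrow>\<^sup>* v} = connected_components G"
proof -
  have "{H. max_subgraph Digraph_Component.connected H} = (\<lambda>u. G \<restriction> {v. u \<rightarrow>\<^sup>* v}) ` verts G"
    by (auto simp: max_connected_subgraph_iff)
  then show ?thesis
    by (auto simp: connected_components_def quotient_def image_image)
qed

lemma dominates_Gamma_iff:
  "u \<rightarrow>\<^bsub>Gamma\<^esub> v \<longleftrightarrow> u \<in> pos_nats \<and> v \<in> pos_nats \<and> (v = T u \<or> u = T v)"
  by (auto simp: Gamma_def Gamma_edges_def arcs_ends_conv image_iff doubleton_eq_iff T_def)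

lemma sym_digraph_Gamma: "sym_digraph Gamma"
proof
  show "symmetric Gamma"
    by (auto simp: symmetric_def dominates_Gamma_iff intro!: symI)
qed (auto simp: Gamma_def Gamma_edges_def doubleton_eq_iff T_def)

interpretation Gamma: sym_digraph Gamma
  by (rule sym_digraph_Gamma)

lemma verts_Gamma: "verts Gamma = pos_nats"
  by (simp add: Gamma_def)

lemma reachable_Gamma_funpow:
  assumes "n \<in> pos_nats"
  shows "n \<rightarrow>\<^sup>*\<^bsub>Gamma\<^esub> (T ^^ i) n"
proof (induction i)
  case 0
  then show ?case using assms by (simp add: verts_Gamma)
next
  case (Suc i)
  then have "(T ^^ i) n \<in> pos_nats"
    using verts_Gamma by (blast elim: reachable_in_vertsE)
  then have "(T ^^ i) n \<rightarrow>\<^bsub>Gamma\<^esub> (T ^^ Suc i) n"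
    by (simp add: dominates_Gamma_iff T_def)
  with Suc show ?case by (rule Gamma.reachable_adj_trans)
qed

lemma reachable_Gamma_imp_orbits_meet:
  assumes "a \<rightarrow>\<^sup>*\<^bsub>Gamma\<^esub> b"
  shows "\<exists>i j. (T ^^ i) a = (T ^^ j) b"
  using assms
proof (induction rule: Gamma.reachable_induct)
  case base
  show ?case by blast
next
  case (step x y)
  then obtain i j where ij: "(T ^^ i) a = (T ^^ j) x" by blast
  from \<open>x \<rightarrow>\<^bsub>Gamma\<^esub> y\<close> consider "y = T x" | "x = T y"
    by (auto simp: dominates_Gamma_iff)
  then show ?case
  proof cases
    case 1
    with ij have "(T ^^ Suc i) a = (T ^^ j) y"
      by (simp add: funpow_swap1)
    then show ?thesis by blast
  next
    case 2
    with ij have "(T ^^ i) a = (T ^^ Suc j) y"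
      by (simp add: funpow_swap1)
    then show ?thesis by blast
  qed
qed

lemma reachable_Gamma_iff:
  "a \<rightarrow>\<^sup>*\<^bsub>Gamma\<^esub> b
    \<longleftrightarrow> a \<in> pos_nats \<and> b \<in> pos_nats \<and> (\<exists>i j. (T ^^ i) a = (T ^^ j) b)"
proof
  assume "a \<rightarrow>\<^sup>*\<^bsub>Gamma\<^esub> b"
  then show "a \<in> pos_nats \<and> b \<in> pos_nats \<and> (\<exists>i j. (T ^^ i) a = (T ^^ j) b)"
    using reachable_Gamma_imp_orbits_meet Gamma.reachable_in_verts verts_Gamma by blast
next
  assume "a \<in> pos_nats \<and> b \<in> pos_nats \<and> (\<exists>i j. (T ^^ i) a = (T ^^ j) b)"
  then show "a \<rightarrow>\<^sup>*\<^bsub>Gamma\<^esub> b"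
    by (metis reachable_Gamma_funpow Gamma.symmetric_reachable' Gamma.reachable_trans)
qed

lemma T_rel_eq_reachable: "T_rel = {(a, b). a \<rightarrow>\<^sup>*\<^bsub>Gamma\<^esub> b}"
  by (simp add: T_rel_def reachable_Gamma_iff)

theorem lemma2p1:
  shows "equiv pos_nats T_rel
    \<and> pos_nats // T_rel = connected_components Gamma
    \<and> ((\<forall>m\<in>pos_nats. \<forall>n\<in>pos_nats. \<exists>i j. (T ^^ i) m = (T ^^ j) n)
        \<longleftrightarrow> Digraph_Component.connected Gamma)"
proof (intro conjI)
  show "equiv pos_nats T_rel"
    using Gamma.equiv_reachable by (simp add: T_rel_eq_reachable verts_Gamma)
  show "pos_nats // T_rel = connected_components Gamma"
    using Gamma.quotient_reachable_eq_connected_components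
    by (simp add: T_rel_eq_reachable verts_Gamma)
  have "pos_nats \<noteq> {}" by auto
  then show "(\<forall>m\<in>pos_nats. \<forall>n\<in>pos_nats. \<exists>i j. (T ^^ i) m = (T ^^ j) n)
      \<longleftrightarrow> Digraph_Component.connected Gamma"
    by (auto simp: Gamma.connected_iff_reachable verts_Gamma reachable_Gamma_iff)
qed

end
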